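(* Let $n \ge 2$ and let $X = \{\theta_{i_1},\ldots,\theta_{i_k}\}$ be a nonempty subset of the set $A(C_n) = \{\theta_1,\ldots,\theta_{n-1}\}$ of coatoms of the lattice $C_n$, where $i_1 < \cdots < i_k$. Then, with respect to the total order $\theta_1 \lhd \theta_2 \lhd \cdots \lhd \theta_{n-1}$, $X$ is an NBB base of $\widehat{0}$ if and only if both of the following hold: (1) $i_1 = 1$; (2) $\{i_2-1, i_3-1, \ldots, i_k-1\}$ is a sparse set in $[n-2]$.
   Context: $C_n$ is the set of all words $c_1c_2\cdots c_k$ with each $c_i \in \{1,2\}$ and $c_1+\cdots+c_k = n$, together with an extra element $\widehat{0}$. The words are ordered by the partial order generated by the covering relations $c_1\cdots c_{i-1}\,2\,c_{i+1}\cdots c_k \prec c_1\cdots c_{i-1}\,1\,1\,c_{i+1}\cdots c_k$, and $\widehat{0}$ is the minimum element, strictly below all words. $C_n$ is a finite lattice with maximum $11\cdots1$. Its coatoms are $\theta_i := 1\cdots 1\,2\,1\cdots 1$ ($1 \le i \le n-1$), the word of length $n-1$ whose $i$-th letter is 2 and whose other letters are 1. Given a total order $\lhd$ on the set of coatoms of a finite lattice $L$, a nonempty set $D$ of coatoms is bounded below (BB) if for every $d \in D$ there is a coatom $a$ of $L$ with $a \lhd d$ (strictly) and $a > \bigwedge D$ in $L$. A set $B$ of coatoms is NBB if it does not contain any bounded below subset $D \subseteq B$; in that case $B$ is called an NBB base of $x = \bigwedge B$. So "$X$ is an NBB base of $\widehat 0$" means that $X$ is NBB and $\bigwedge X = \widehat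 0$. For $m\ge 0$, $[m] = \{1,\ldots,m\}$ (with $[0]=\emptyset$). A subset $S \subseteq [m]$ is a sparse set if $1 \in S$ and, whenever $i \in S$ with $1 \le i \le m-1$, $i+1 \notin S$. In particular the empty set is not sparse. *)

theory Defs
  imports "HOL-Algebra.Lattice"
begin

section \<open>The lattice \<open>C\<^sub>n\<close>\<close>

datatype comp_elem = Zero_hat | Word "nat list"

definition comp_words :: "nat \<Rightarrow> nat list set" where
  "comp_words n = {w. set w \<subseteq> {1, 2} \<and> sum_list w = n}"

inductive word_covered :: "nat list \<Rightarrow> nat list \<Rightarrow> bool" where
  split_two: "word_covered (u @ [2] @ v) (u @ [1, 1] @ v)"

fun comp_le :: "comp_elem \<Rightarrow> comp_elem \<Rightarrow> bool" where
  "comp_le Zero_hat y \<longleftrightarrow> True"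
| "comp_le (Word v) Zero_hat \<longleftrightarrow> False"
| "comp_le (Word v) (Word w) \<longleftrightarrow> word_covered\<^sup>*\<^sup>* v w"

definition comp_lattice :: "nat \<Rightarrow> comp_elem gorder" where
  "comp_lattice n =
     \<lparr>carrier = insert Zero_hat (Word ` comp_words n), eq = (=), le = comp_le\<rparr>"

text \<open>Meaningful for \<open>1 \<le> i \<le> n - 1\<close>; the word then has length \<open>n - 1\<close>.\<close>

definition theta :: "nat \<Rightarrow> nat \<Rightarrow> comp_elem" where
  "theta n i = Word (replicate (i - 1) 1 @ [2] @ replicate (n - 1 - i) 1)"

definition theta_less :: "nat \<Rightarrow> comp_elem \<Rightarrow> comp_elem \<Rightarrow> bool" where
  "theta_less n a b \<longleftrightarrow> (\<exists>i j. 1 \<le> i \<and> i < j \<and> j \<le> n - 1 \<and> a = theta n i \<and> b = theta n j)"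


section \<open>NBB bases\<close>

text \<open>
  In the following, \<open>L\<close> is meant to be a finite lattice, so that \<open>\<top>\<^bsub>L\<^esub>\<close> and \<open>\<Sqinter>\<^bsub>L\<^esub> D\<close>
  exist, and \<open>lhd\<close> the strict part of a total order on its coatoms.
\<close>

definition coatoms :: "('a, 'b) gorder_scheme \<Rightarrow> 'a set" where
  "coatoms L = {a \<in> carrier L. a \<sqsubset>\<^bsub>L\<^esub> \<top>\<^bsub>L\<^esub> \<and> \<not> (\<exists>y \<in> carrier L. a \<sqsubset>\<^bsub>L\<^esub> y \<and> y \<sqsubset>\<^bsub>L\<^esub> \<top>\<^bsub>L\<^esub>)}"

definition bounded_below ::
    "('a, 'b) gorder_scheme \<Rightarrow> ('a \<Rightarrow> 'a \<Rightarrow> bool) \<Rightarrow> 'a set \<Rightarrow> bool" where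
  "bounded_below L lhd D \<longleftrightarrow>
     D \<noteq> {} \<and> D \<subseteq> coatoms L \<and> (\<forall>d \<in> D. \<exists>a \<in> coatoms L. lhd a d \<and> \<Sqinter>\<^bsub>L\<^esub> D \<sqsubset>\<^bsub>L\<^esub> a)"

definition NBB :: "('a, 'b) gorder_scheme \<Rightarrow> ('a \<Rightarrow> 'a \<Rightarrow> bool) \<Rightarrow> 'a set \<Rightarrow> bool" where
  "NBB L lhd B \<longleftrightarrow> B \<subseteq> coatoms L \<and> \<not> (\<exists>D \<subseteq> B. bounded_below L lhd D)"

definition NBB_base ::
    "('a, 'b) gorder_scheme \<Rightarrow> ('a \<Rightarrow> 'a \<Rightarrow> bool) \<Rightarrow> 'a set \<Rightarrow> 'a \<Rightarrow> bool" where
  "NBB_base L lhd B x \<longleftrightarrow> NBB L lhd B \<and> \<Sqinter>\<^bsub>L\<^esub> B = x"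


section \<open>Sparse sets\<close>

definition sparse_set :: "nat \<Rightarrow> nat set \<Rightarrow> bool" where
  "sparse_set m S \<longleftrightarrow>
     S \<subseteq> {1..m} \<and> 1 \<in> S \<and> (\<forall>i. i \<in> S \<and> 1 \<le> i \<and> i \<le> m - 1 \<longrightarrow> i + 1 \<notin> S)"

end

theory Submission
  imports Defs
begin

text \<open>
  A word of sum \<open>n\<close> is a tiling of \<open>{1..n}\<close> by monominoes and dominoes, determined by the set
  of left ends of its dominoes. These sets are exactly the subsets of \<open>{1..n - 1}\<close> without two
  consecutive elements, the order on words becomes reverse inclusion, and \<open>\<theta>\<^sub>i\<close> corresponds
  to \<open>{i}\<close>. Hence the meet of \<open>{\<theta>\<^sub>i | i \<in> D}\<close> is the word with domino set \<open>D\<close> when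
  \<open>D\<close> has no two consecutive elements, and \<open>Zero_hat\<close> otherwise. In the first case the only
  coatoms above the meet are those of \<open>D\<close> itself, so the least element of \<open>D\<close> shows that \<open>D\<close> is
  not bounded below; in the second case all coatoms lie above the meet, so \<open>D\<close> is bounded below
  iff \<open>1 \<notin> D\<close>. Thus an NBB base of \<open>Zero_hat\<close> must contain consecutive indices, but only the
  pair \<open>1, 2\<close>.
\<close>

section \<open>Domino sets of words\<close>

text \<open>The parameter \<open>p\<close> is the position at which the first letter starts.\<close>

fun doms :: "nat \<Rightarrow> nat list \<Rightarrow> nat set" where
  "doms p [] = {}"
| "doms p (c # w) = (if c = 2 then {p} else {}) \<union> doms (p + c) w"

definition nonadj :: "nat set \<Rightarrow> bool" where
  "nonadj D \<longleftrightarrow> (\<forall>j \<in> D. Suc j \<notin> D)"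

lemma nonadj_mono: "nonadj E \<Longrightarrow> D \<subseteq> E \<Longrightarrow> nonadj D"
  by (auto simp: nonadj_def)

text \<open>If \<open>Suc j\<close> lies in a subset of \<open>{1..m}\<close>, then \<open>j\<close>
  is at most \<open>m - 1\<close>, so the range condition in \<open>sparse_set\<close> covers every
  pair of neighbours.\<close>

lemma sparse_set_iff_nonadj: "sparse_set m S \<longleftrightarrow> S \<subseteq> {1..m} \<and> 1 \<in> S \<and> nonadj S"
proof -
  have "j \<le> m - 1" if "S \<subseteq> {1..m}" "Suc j \<in> S" for j
    using that by fastforce
  then show ?thesis
    by (fastforce simp: sparse_set_def nonadj_def)
qed

lemma doms_append: "doms p (u @ v) = doms p u \<union> doms (p + sum_list u) v"
  by (induction u arbitrary: p) (auto simp: add.assoc)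

lemma doms_ge: "j \<in> doms p w \<Longrightarrow> p \<le> j"
proof (induction w arbitrary: p)
  case (Cons c w)
  show ?case
    using Cons.prems Cons.IH[of "p + c"] by (auto split: if_splits)
qed simp

text \<open>A domino starting at \<open>j\<close> also occupies \<open>Suc j\<close>, which must
  come before the end position \<open>p + sum_list w\<close>.\<close>

lemma doms_bound: "j \<in> doms p w \<Longrightarrow> Suc j < p + sum_list w"
proof (induction w arbitrary: p)
  case (Cons c w)
  show ?case
    using Cons.prems Cons.IH[of "p + c"] by (auto split: if_splits)
qed simp

text \<open>A domino at \<open>p\<close> pushes the next letter to \<open>p + 2\<close>, so no
  domino can start at \<open>Suc p\<close>.\<close>

lemma nonadj_doms: "set w \<subseteq> {1, 2} \<Longrightarrow> nonadj (doms p w)"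
proof (induction w arbitrary: p)
  case (Cons c w)
  then show ?case
    using Cons.IH[of "p + c"] doms_ge[of p "p + c" w] doms_ge[of "Suc p" "p + c" w]
    by (auto simp: nonadj_def dest: doms_ge)
qed (simp add: nonadj_def)

lemma doms_replicate_one: "doms p (replicate m 1) = {}"
  by (induction m arbitrary: p) auto

lemma replicate_one_comp_words: "replicate n 1 \<in> comp_words n"
  by (auto simp: comp_words_def sum_list_replicate)

lemma doms_theta:
  assumes "1 \<le> i"
  shows "doms 1 (replicate (i - 1) 1 @ [2] @ replicate m 1) = {i}"
  using assms by (simp add: doms_append doms_replicate_one sum_list_replicate del: One_nat_def)

text \<open>The tiling is built from the left: a domino at \<open>p\<close> if \<open>p\<close>
  belongs to \<open>D\<close>, a monomino otherwise. The induction is strong because a domino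
  shortens the rest by 2.\<close>

lemma exists_word_doms:
  assumes "nonadj D" "D \<subseteq> {p..<p + (m - 1)}"
  shows "\<exists>w. w \<in> comp_words m \<and> doms p w = D"
  using assms
proof (induction m arbitrary: p D rule: less_induct)
  case (less m)
  show ?case
  proof (cases "m = 0")
    case True
    with less.prems have "[] \<in> comp_words m \<and> doms p [] = D"
      by (auto simp: comp_words_def)
    then show ?thesis ..
  next
    case False
    show ?thesis
    proof (cases "p \<in> D")
      case True
      with less.prems(2) have m: "2 \<le> m"
        by force
      have "Suc p \<notin> D"
        using less.prems(1) True by (auto simp: nonadj_def)
      \<comment> \<open>For \<open>m = 2\<close> and \<open>m = 3\<close> truncated subtraction
        makes this interval empty; it then says that \<open>D\<close> contains only
        \<open>p\<close>.\<close>
      have "D - {p} \<subseteq> {p + 2..<p + 2 + (m - 2 - 1)}"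
      proof
        fix j
        assume j: "j \<in> D - {p}"
        then have "p \<le> j" "j < p + (m - 1)" "j \<noteq> p" "j \<noteq> Suc p"
          using less.prems(2) \<open>Suc p \<notin> D\<close> by auto
        then show "j \<in> {p + 2..<p + 2 + (m - 2 - 1)}"
          by simp
      qed
      moreover have "nonadj (D - {p})"
        using less.prems(1) by (auto simp: nonadj_def)
      ultimately obtain w where "w \<in> comp_words (m - 2)" "doms (p + 2) w = D - {p}"
        using less.IH[of "m - 2" "D - {p}" "p + 2"] m by auto
      then have "2 # w \<in> comp_words m \<and> doms p (2 # w) = D"
        using m True by (auto simp: comp_words_def)
      then show ?thesis ..
    next
      case notin: False
      have "D \<subseteq> {p + 1..<p + 1 + (m - 1 - 1)}"
      proof
        fix j
        assume j: "j \<in> D"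
        then have "p \<le> j" "j < p + (m - 1)" "j \<noteq> p"
          using less.prems(2) notin by auto
        then show "j \<in> {p + 1..<p + 1 + (m - 1 - 1)}"
          by simp
      qed
      then obtain w where "w \<in> comp_words (m - 1)" "doms (p + 1) w = D"
        using less.IH[of "m - 1" D "p + 1"] False less.prems(1) by auto
      then have "1 # w \<in> comp_words m \<and> doms p (1 # w) = D"
        using False by (auto simp: comp_words_def)
      then show ?thesis ..
    qed
  qed
qed

section \<open>The order on words as reverse inclusion of domino sets\<close>

text \<open>Every covering step adds one letter; this is the source of antisymmetry.\<close>

lemma word_covered_length: "word_covered\<^sup>*\<^sup>* v w \<Longrightarrow> v = w \<or> length v < length w"
  by (induction rule: rtranclp_induct) (auto elim!: word_covered.cases)

text \<open>Splitting a domino deletes its left end and shifts no later letter.\<close>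

lemma word_covered_doms: "word_covered\<^sup>*\<^sup>* v w \<Longrightarrow> doms p w \<subseteq> doms p v"
proof (induction rule: rtranclp_induct)
  case (step v w)
  have "doms p w \<subseteq> doms p v"
    using step.hyps(2) by cases (auto simp: doms_append)
  with step.IH show ?case by blast
qed simp

lemma word_covered_Cons: "word_covered\<^sup>*\<^sup>* v w \<Longrightarrow> word_covered\<^sup>*\<^sup>* (c # v) (c # w)"
proof (induction rule: rtranclp_induct)
  case (step v w)
  have "word_covered (c # v) (c # w)"
    using step.hyps(2)
  proof cases
    case (split_two a b)
    then show ?thesis
      using word_covered.split_two[of "c # a" b] by simp
  qed
  with step.IH show ?case by simp
qed simp

text \<open>The words are compared from the left. Equal first letters are stripped. If
  \<open>v\<close> starts with 1 and \<open>w\<close> with 2, then \<open>p\<close> violates the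
  inclusion. If \<open>v\<close> starts with 2 and \<open>w\<close> with 1, then \<open>w\<close>
  continues with another 1, so splitting the first domino of \<open>v\<close> makes the two prefixes
  agree.\<close>

lemma word_covered_if_doms:
  assumes "set v \<subseteq> {1, 2}" "set w \<subseteq> {1, 2}" "sum_list v = sum_list w" "doms p w \<subseteq> doms p v"
  shows "word_covered\<^sup>*\<^sup>* v w"
  using assms
proof (induction v arbitrary: w p)
  case Nil
  then have "w = []"
    by (cases w) auto
  then show ?case by simp
next
  case (Cons a v)
  then have a: "a = 1 \<or> a = 2" by simp
  then obtain c w' where w: "w = c # w'"
    using Cons.prems by (cases w) auto
  then have c: "c = 1 \<or> c = 2"
    using Cons.prems by simp
  show ?case
  proof (cases "c = a")
    case True
    have "doms (p + a) w' \<subseteq> doms (p + a) v"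
    proof
      fix j
      assume j: "j \<in> doms (p + a) w'"
      then have "j \<in> doms p (a # v)"
        using Cons.prems(4) w True by auto
      with doms_ge[OF j] a show "j \<in> doms (p + a) v"
        by (auto split: if_splits)
    qed
    then have "word_covered\<^sup>*\<^sup>* v w'"
      using Cons.prems w True by (intro Cons.IH[of w' "p + a"]) auto
    then show ?thesis
      using w True word_covered_Cons by blast
  next
    case neq: False
    show ?thesis
    proof (cases "c = 2")
      case True
      then have "a = 1" using a neq by simp
      have "p \<in> doms p (a # v)"
        using Cons.prems(4) w True by auto
      then have False
        using \<open>a = 1\<close> doms_ge[of p "p + 1" v] by auto
      then show ?thesis ..
    next
      case False
      then have ac: "a = 2" "c = 1"
        using a c neq by auto
      then obtain d w'' where w': "w' = d # w''"
        using Cons.prems w by (cases w') auto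
      \<comment> \<open>A domino of \<open>w\<close> at \<open>Suc p\<close> would have to be one of
        \<open>v\<close>, where that cell is already covered by the domino at
        \<open>p\<close>.\<close>
      have "d \<noteq> 2"
      proof
        assume "d = 2"
        then have "Suc p \<in> doms p (a # v)"
          using Cons.prems(4) w w' ac by auto
        then show False
          using ac doms_ge[of "Suc p" "p + 2" v] by auto
      qed
      then have d: "d = 1"
        using Cons.prems w w' by auto
      have "doms (p + 2) w'' \<subseteq> doms (p + 2) v"
      proof
        fix j
        assume j: "j \<in> doms (p + 2) w''"
        then have "j \<in> doms p (a # v)"
          using Cons.prems(4) w w' ac d by auto
        with doms_ge[OF j] ac show "j \<in> doms (p + 2) v"
          by auto
      qed
      then have "word_covered\<^sup>*\<^sup>* v w''"
        using Cons.prems w w' ac d by (intro Cons.IH[of w'' "p + 2"]) auto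
      then have "word_covered\<^sup>*\<^sup>* (1 # 1 # v) (1 # 1 # w'')"
        by (intro word_covered_Cons)
      moreover have "word_covered (2 # v) (1 # 1 # v)"
        using word_covered.split_two[of "[]" v] by simp
      ultimately show ?thesis
        using w w' ac d by (simp add: converse_rtranclp_into_rtranclp)
    qed
  qed
qed

lemma word_covered_iff_doms:
  assumes "v \<in> comp_words n" "w \<in> comp_words n"
  shows "word_covered\<^sup>*\<^sup>* v w \<longleftrightarrow> doms 1 w \<subseteq> doms 1 v"
  using assms word_covered_doms word_covered_if_doms[of v w 1] by (auto simp: comp_words_def)

lemma word_covered_antisym: "word_covered\<^sup>*\<^sup>* v w \<Longrightarrow> word_covered\<^sup>*\<^sup>* w v \<Longrightarrow> v = w"
  using word_covered_length[of v w] word_covered_length[of w v] by auto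

text \<open>Equal domino sets include each other, so injectivity is read off from
  antisymmetry.\<close>

lemma doms_inj:
  assumes "v \<in> comp_words n" "w \<in> comp_words n" "doms 1 v = doms 1 w"
  shows "v = w"
  using assms by (intro word_covered_antisym) (simp_all add: word_covered_iff_doms)

section \<open>The partial order, its top and its coatoms\<close>

text \<open>The order axioms make greatest elements unique, which identifies the top and the meets,
  both defined by choice.\<close>

lemma partial_order_comp_lattice: "partial_order (comp_lattice n)"
proof -
  have antisym: "comp_le x y \<Longrightarrow> comp_le y x \<Longrightarrow> x = y" for x y
    by (cases x; cases y) (auto intro: word_covered_antisym)
  have trans: "comp_le x y \<Longrightarrow> comp_le y z \<Longrightarrow> comp_le x z" for x y z
    by (cases x; cases y; cases z) auto
  have refl: "comp_le x x" for x
    by (cases x) auto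
  show ?thesis
    by unfold_locales (auto simp: comp_lattice_def intro: antisym trans refl word_covered_antisym)
qed

lemma carrier_comp_lattice: "carrier (comp_lattice n) = insert Zero_hat (Word ` comp_words n)"
  by (simp add: comp_lattice_def)

lemma le_comp_lattice: "x \<sqsubseteq>\<^bsub>comp_lattice n\<^esub> y \<longleftrightarrow> comp_le x y"
  by (simp add: comp_lattice_def)

lemma less_comp_lattice: "x \<sqsubset>\<^bsub>comp_lattice n\<^esub> y \<longleftrightarrow> comp_le x y \<and> x \<noteq> y"
  by (simp add: comp_lattice_def lless_def)

lemma theta_Word:
  assumes "1 \<le> i" "i \<le> n - 1"
  obtains w where "theta n i = Word w" "w \<in> comp_words n" "doms 1 w = {i}"
proof
  let ?w = "replicate (i - 1) 1 @ [2] @ replicate (n - 1 - i) 1"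
  show "theta n i = Word ?w"
    by (simp add: theta_def)
  show "?w \<in> comp_words n"
    using assms by (auto simp: comp_words_def sum_list_replicate)
  show "doms 1 ?w = {i}"
    using assms doms_theta by blast
qed

lemma Word_le_theta:
  assumes "w \<in> comp_words n" "1 \<le> i" "i \<le> n - 1"
  shows "comp_le (Word w) (theta n i) \<longleftrightarrow> i \<in> doms 1 w"
  using assms theta_Word[of i n] by (metis comp_le.simps(3) empty_subsetI insert_subset word_covered_iff_doms)

lemma theta_carrier: "1 \<le> i \<Longrightarrow> i \<le> n - 1 \<Longrightarrow> theta n i \<in> carrier (comp_lattice n)"
  using theta_Word[of i n] by (auto simp: carrier_comp_lattice)

lemma theta_inj:
  assumes "1 \<le> i" "i \<le> n - 1" "1 \<le> j" "j \<le> n - 1" "theta n i = theta n j"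
  shows "i = j"
  by (metis assms theta_Word comp_elem.inject singleton_inject)

lemma doms_range: "w \<in> comp_words n \<Longrightarrow> doms 1 w \<subseteq> {1..n - 1}"
  using doms_ge[of _ 1 w] doms_bound[of _ 1 w] by (force simp: comp_words_def)

lemma top_comp_lattice: "\<top>\<^bsub>comp_lattice n\<^esub> = Word (replicate n 1)"
proof -
  interpret partial_order "comp_lattice n"
    by (rule partial_order_comp_lattice)
  have "comp_le x (Word (replicate n 1))" if "x \<in> carrier (comp_lattice n)" for x
    using that replicate_one_comp_words word_covered_iff_doms[of _ n "replicate n 1"] doms_replicate_one[of 1 n]
    by (auto simp: carrier_comp_lattice simp del: One_nat_def)
  then have "greatest (comp_lattice n) (Word (replicate n 1)) (carrier (comp_lattice n))"
    using replicate_one_comp_words by (simp add: greatest_def le_comp_lattice carrier_comp_lattice)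
  then show ?thesis
    unfolding top_def by (metis greatest_unique someI)
qed

text \<open>Every element other than the top lies below some \<open>theta n i\<close>, and an
  element above \<open>theta n i\<close> has domino set \<open>{i}\<close> or the empty set.\<close>

lemma coatoms_comp_lattice:
  assumes "n \<ge> 2"
  shows "coatoms (comp_lattice n) = theta n ` {1..n - 1}"
proof (intro equalityI subsetI)
  fix a
  assume a: "a \<in> coatoms (comp_lattice n)"
  let ?t = "Word (replicate n 1)"
  from a have a1: "a \<in> carrier (comp_lattice n)" "a \<noteq> ?t"
    and max: "y \<in> carrier (comp_lattice n) \<Longrightarrow> comp_le a y \<Longrightarrow> a = y \<or> \<not> comp_le y ?t \<or> y = ?t" for y
    by (auto simp: coatoms_def top_comp_lattice less_comp_lattice)
  obtain i where i: "i \<in> {1..n - 1}" "comp_le a (theta n i)"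
  proof (cases a)
    case Zero_hat
    \<comment> \<open>Here \<open>n >= 2\<close> matters: for smaller \<open>n\<close> the element
      \<open>Zero_hat\<close> would itself be a coatom.\<close>
    then show ?thesis
      using that[of 1] assms by simp
  next
    case (Word w)
    then have w: "w \<in> comp_words n"
      using a1 by (auto simp: carrier_comp_lattice)
    have "doms 1 w \<noteq> {}"
      using doms_inj[OF w replicate_one_comp_words] a1(2) Word doms_replicate_one[of 1 n] by auto
    then obtain i where "i \<in> doms 1 w"
      by blast
    moreover from this have "i \<in> {1..n - 1}"
      using doms_range[OF w] by blast
    ultimately show ?thesis
      using that[of i] Word Word_le_theta[OF w, of i] by simp
  qed
  obtain v where v: "theta n i = Word v" "v \<in> comp_words n" "doms 1 v = {i}"
    using theta_Word[of i n] i(1) by auto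
  have "a = theta n i"
  proof -
    have "comp_le (Word v) ?t"
      using v replicate_one_comp_words doms_replicate_one[of 1 n] by (simp add: word_covered_iff_doms del: One_nat_def)
    moreover have "Word v \<noteq> ?t"
      using v(3) doms_replicate_one[of 1 n] by fastforce
    ultimately show ?thesis
      using max[of "theta n i"] i v by (auto simp: carrier_comp_lattice)
  qed
  with i show "a \<in> theta n ` {1..n - 1}"
    by blast
next
  fix a
  assume "a \<in> theta n ` {1..n - 1}"
  then obtain i where "1 \<le> i" "i \<le> n - 1" "a = theta n i"
    by auto
  then obtain v where v: "a = Word v" "v \<in> comp_words n" "doms 1 v = {i}"
    using theta_Word[of i n] by metis
  let ?t = "Word (replicate n 1)"
  have le: "comp_le a ?t"
    using v replicate_one_comp_words doms_replicate_one[of 1 n] by (simp add: word_covered_iff_doms del: One_nat_def)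
  have "a \<noteq> ?t"
    using v doms_replicate_one[of 1 n] by fastforce
  moreover have "y = a \<or> y = ?t" if y: "y \<in> carrier (comp_lattice n)" "comp_le a y" for y
  proof -
    obtain w where w: "y = Word w" "w \<in> comp_words n"
      using y v(1) by (cases y) (auto simp: carrier_comp_lattice)
    then have "doms 1 w \<subseteq> {i}"
      using y v word_covered_iff_doms by auto
    then consider "doms 1 w = doms 1 (replicate n 1)" | "doms 1 w = doms 1 v"
      using v(3) doms_replicate_one[of 1 n] by auto
    then show ?thesis
    proof cases
      case 1
      then show ?thesis
        using doms_inj[OF w(2) replicate_one_comp_words] w(1) by simp
    next
      case 2
      then show ?thesis
        using doms_inj[OF w(2) v(2)] w(1) v(1) by simp
    qed
  qed
  moreover have "a \<in> carrier (comp_lattice n)"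
    using v by (simp add: carrier_comp_lattice)
  ultimately show "a \<in> coatoms (comp_lattice n)"
    using le unfolding coatoms_def top_comp_lattice less_comp_lattice by blast
qed

section \<open>Meets of sets of coatoms\<close>

lemma Inf_theta_eqI:
  assumes "D \<subseteq> {1..n - 1}" "x \<in> carrier (comp_lattice n)"
    and "\<And>i. i \<in> D \<Longrightarrow> comp_le x (theta n i)"
    and "\<And>y. y \<in> carrier (comp_lattice n) \<Longrightarrow> (\<And>i. i \<in> D \<Longrightarrow> comp_le y (theta n i)) \<Longrightarrow> comp_le y x"
  shows "\<Sqinter>\<^bsub>comp_lattice n\<^esub> (theta n ` D) = x"
proof -
  interpret partial_order "comp_lattice n"
    by (rule partial_order_comp_lattice)
  have carrier: "theta n ` D \<subseteq> carrier (comp_lattice n)"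
    using assms(1) by (auto intro!: theta_carrier)
  have "greatest (comp_lattice n) x (Lower (comp_lattice n) (theta n ` D))"
  proof (rule greatest_LowerI[OF _ _ carrier assms(2)])
    fix y
    assume "y \<in> theta n ` D"
    then show "x \<sqsubseteq>\<^bsub>comp_lattice n\<^esub> y"
      using assms(3) by (auto simp: le_comp_lattice)
  next
    fix y
    assume y: "y \<in> Lower (comp_lattice n) (theta n ` D)"
    then have "comp_le y (theta n i)" if "i \<in> D" for i
      using carrier that unfolding Lower_def le_comp_lattice by blast
    moreover have "y \<in> carrier (comp_lattice n)"
      using y by (simp add: Lower_def)
    ultimately show "y \<sqsubseteq>\<^bsub>comp_lattice n\<^esub> x"
      using assms(4) by (simp add: le_comp_lattice)
  qed
  then show ?thesis
    unfolding inf_def by (metis greatest_unique someI)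
qed

lemma subset_doms_if_lower:
  assumes "v \<in> comp_words n" "D \<subseteq> {1..n - 1}" "\<And>i. i \<in> D \<Longrightarrow> comp_le (Word v) (theta n i)"
  shows "D \<subseteq> doms 1 v"
proof
  fix j
  assume "j \<in> D"
  then show "j \<in> doms 1 v"
    using assms(2,3) Word_le_theta[OF assms(1), of j] by auto
qed

text \<open>The words below all these coatoms are those whose domino set contains \<open>D\<close>,
  so the one with domino set exactly \<open>D\<close> is the greatest. The empty \<open>D\<close>
  gives the top.\<close>

lemma Inf_theta_nonadj:
  assumes "D \<subseteq> {1..n - 1}" "nonadj D"
  obtains w where "w \<in> comp_words n" "doms 1 w = D" "\<Sqinter>\<^bsub>comp_lattice n\<^esub> (theta n ` D) = Word w"
proof -
  have "D \<subseteq> {1..<1 + (n - 1)}"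
    using assms(1) by force
  then obtain w where w: "w \<in> comp_words n" "doms 1 w = D"
    using exists_word_doms[OF assms(2)] by blast
  have "\<Sqinter>\<^bsub>comp_lattice n\<^esub> (theta n ` D) = Word w"
  proof (rule Inf_theta_eqI[OF assms(1)])
    show "Word w \<in> carrier (comp_lattice n)"
      using w by (simp add: carrier_comp_lattice)
    show "comp_le (Word w) (theta n i)" if "i \<in> D" for i
      using that w assms(1) Word_le_theta[of w n i] by auto
    show "comp_le y (Word w)"
      if y: "y \<in> carrier (comp_lattice n)" "\<And>i. i \<in> D \<Longrightarrow> comp_le y (theta n i)" for y
    proof (cases y)
      case (Word v)
      then have v: "v \<in> comp_words n"
        using y(1) by (auto simp: carrier_comp_lattice)
      have "D \<subseteq> doms 1 v"
        using y(2) Word by (intro subset_doms_if_lower[OF v assms(1)]) simp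
      then show ?thesis
        using Word v w word_covered_iff_doms by simp
    qed simp
  qed
  with w that show ?thesis by blast
qed

text \<open>A word below all these coatoms would have two overlapping dominoes, so
  \<open>Zero_hat\<close> is the only lower bound.\<close>

lemma Inf_theta_adj:
  assumes "D \<subseteq> {1..n - 1}" "\<not> nonadj D"
  shows "\<Sqinter>\<^bsub>comp_lattice n\<^esub> (theta n ` D) = Zero_hat"
proof (rule Inf_theta_eqI[OF assms(1)])
  show "comp_le y Zero_hat"
    if y: "y \<in> carrier (comp_lattice n)" "\<And>i. i \<in> D \<Longrightarrow> comp_le y (theta n i)" for y
  proof (cases y)
    case (Word v)
    then have v: "v \<in> comp_words n"
      using y(1) by (auto simp: carrier_comp_lattice)
    have "D \<subseteq> doms 1 v"
      using y(2) Word by (intro subset_doms_if_lower[OF v assms(1)]) simp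
    moreover have "nonadj (doms 1 v)"
      using v nonadj_doms by (simp add: comp_words_def)
    ultimately show ?thesis
      using assms(2) nonadj_mono by blast
  qed simp
qed (simp_all add: carrier_comp_lattice)

section \<open>Bounded below sets and NBB bases\<close>

lemma theta_less_theta_iff:
  assumes "1 \<le> i" "i \<le> n - 1" "1 \<le> j" "j \<le> n - 1"
  shows "theta_less n (theta n i) (theta n j) \<longleftrightarrow> i < j"
proof
  assume "theta_less n (theta n i) (theta n j)"
  then obtain i' j' where ij: "1 \<le> i'" "i' < j'" "j' \<le> n - 1"
    "theta n i = theta n i'" "theta n j = theta n j'"
    by (auto simp: theta_less_def)
  then have "i = i'" "j = j'"
    using assms by (auto intro!: theta_inj)
  with ij show "i < j" by simp
qed (use assms in \<open>auto simp: theta_less_def\<close>)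

lemma bounded_below_theta_iff:
  assumes "n \<ge> 2" "D \<subseteq> {1..n - 1}"
  shows "bounded_below (comp_lattice n) (theta_less n) (theta n ` D) \<longleftrightarrow> \<not> nonadj D \<and> 1 \<notin> D"
proof
  assume "bounded_below (comp_lattice n) (theta_less n) (theta n ` D)"
  then have D: "D \<noteq> {}"
    and bb: "\<And>d. d \<in> D \<Longrightarrow> \<exists>a \<in> {1..n - 1}. theta_less n (theta n a) (theta n d) \<and>
      comp_le (\<Sqinter>\<^bsub>comp_lattice n\<^esub> (theta n ` D)) (theta n a)"
    using assms by (auto simp: bounded_below_def coatoms_comp_lattice less_comp_lattice simp del: One_nat_def)
  have smaller: "\<exists>a \<in> {1..n - 1}. a < d \<and> comp_le (\<Sqinter>\<^bsub>comp_lattice n\<^esub> (theta n ` D)) (theta n a)"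
    if "d \<in> D" for d
    using bb[OF that] that assms(2) theta_less_theta_iff by (meson atLeastAtMost_iff subsetD)
  have "1 \<notin> D"
    using smaller[of 1] by fastforce
  moreover have "\<not> nonadj D"
  proof
    assume "nonadj D"
    then obtain w where w: "w \<in> comp_words n" "doms 1 w = D"
      "\<Sqinter>\<^bsub>comp_lattice n\<^esub> (theta n ` D) = Word w"
      using Inf_theta_nonadj assms(2) by blast
    have "(LEAST d. d \<in> D) \<in> D"
      using D by (metis LeastI ex_in_conv)
    \<comment> \<open>A coatom above \<open>Word w\<close> has its index in \<open>doms 1 w\<close>,
      that is, in \<open>D\<close>.\<close>
    from smaller[OF this] obtain a where "a < (LEAST d. d \<in> D)" "a \<in> D"
      using w Word_le_theta by fastforce
    then show False
      using not_less_Least by blast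
  qed
  ultimately show "\<not> nonadj D \<and> 1 \<notin> D" by blast
next
  assume D: "\<not> nonadj D \<and> 1 \<notin> D"
  \<comment> \<open>The single coatom \<open>theta n 1\<close> serves as witness for every member of
    the set.\<close>
  have "\<Sqinter>\<^bsub>comp_lattice n\<^esub> (theta n ` D) \<sqsubset>\<^bsub>comp_lattice n\<^esub> theta n 1"
    using Inf_theta_adj[OF assms(2)] D by (simp add: less_comp_lattice theta_def)
  moreover have "theta_less n (theta n 1) (theta n d)" if "d \<in> D" for d
  proof -
    have "d \<noteq> 1" "1 \<le> d" "d \<le> n - 1"
      using that D assms(2) by auto
    then show ?thesis
      using theta_less_theta_iff[of 1 n d] by simp
  qed
  moreover have "D \<noteq> {}"
    using D by (auto simp: nonadj_def)
  moreover have "theta n 1 \<in> coatoms (comp_lattice n)"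
    using assms(1) by (auto simp: coatoms_comp_lattice)
  moreover have "theta n ` D \<subseteq> coatoms (comp_lattice n)"
    using assms by (auto simp: coatoms_comp_lattice)
  ultimately show "bounded_below (comp_lattice n) (theta_less n) (theta n ` D)"
    by (auto simp: bounded_below_def simp del: One_nat_def)
qed

lemma NBB_base_Zero_hat_iff:
  assumes "n \<ge> 2" "S \<subseteq> {1..n - 1}"
  shows "NBB_base (comp_lattice n) (theta_less n) (theta n ` S) Zero_hat \<longleftrightarrow>
    1 \<in> S \<and> 2 \<in> S \<and> nonadj (S - {1})"
proof -
  have "\<Sqinter>\<^bsub>comp_lattice n\<^esub> (theta n ` S) = Zero_hat \<longleftrightarrow> \<not> nonadj S"
    using Inf_theta_adj[OF assms(2)] by (cases "nonadj S") (auto elim: Inf_theta_nonadj[OF assms(2)])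
  moreover have "NBB (comp_lattice n) (theta_less n) (theta n ` S) \<longleftrightarrow> nonadj (S - {1})"
  proof -
    have "NBB (comp_lattice n) (theta_less n) (theta n ` S) \<longleftrightarrow>
      \<not> (\<exists>D \<subseteq> S. bounded_below (comp_lattice n) (theta_less n) (theta n ` D))"
      using assms by (auto simp: NBB_def coatoms_comp_lattice subset_image_iff)
    also have "\<dots> \<longleftrightarrow> \<not> (\<exists>D \<subseteq> S. \<not> nonadj D \<and> 1 \<notin> D)"
      using bounded_below_theta_iff[OF assms(1) subset_trans[OF _ assms(2)]] by simp
    \<comment> \<open>\<open>S - {1}\<close> is the largest subset of \<open>S\<close> avoiding 1,
      and \<open>nonadj\<close> passes to subsets.\<close>
    also have "\<dots> \<longleftrightarrow> nonadj (S - {1})"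
    proof -
      have "S - {1} \<subseteq> S" "1 \<notin> S - {1}"
        by auto
      moreover have "nonadj D" if "nonadj (S - {1})" "D \<subseteq> S" "1 \<notin> D" for D
        using that by (intro nonadj_mono[OF that(1)]) auto
      ultimately show ?thesis by blast
    qed
    finally show ?thesis .
  qed
  \<comment> \<open>Removing 1 must destroy every adjacent pair of \<open>S\<close>; as 0 is not in
    \<open>S\<close>, the only such pair is 1, 2.\<close>
  moreover have "\<not> nonadj S \<and> nonadj (S - {1}) \<longleftrightarrow> 1 \<in> S \<and> 2 \<in> S \<and> nonadj (S - {1})"
    using assms(2) by (auto simp: nonadj_def numeral_2_eq_2)
  ultimately show ?thesis
    by (auto simp: NBB_base_def)
qed

section \<open>Translation to the shifted index set\<close>

theorem theorem3p2:
  fixes n k :: nat and i :: "nat \<Rightarrow> nat" and X :: "comp_elem set"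
  assumes "n \<ge> 2"
    and "k \<ge> 1"
    and "strict_mono_on {1..k} i"
    and "i ` {1..k} \<subseteq> {1..n - 1}"
    and "X = (\<lambda>j. theta n (i j)) ` {1..k}"
  shows "NBB_base (comp_lattice n) (theta_less n) X Zero_hat \<longleftrightarrow>
           i 1 = 1 \<and> sparse_set (n - 2) ((\<lambda>j. i j - 1) ` {2..k})"
proof -
  define S where "S = i ` {1..k}"
  define T where "T = (\<lambda>j. i j - 1) ` {2..k}"
  have S: "S \<subseteq> {1..n - 1}" and X: "X = theta n ` S"
    using assms(4,5) by (auto simp: S_def)
  have min: "i 1 < i j" if "j \<in> {2..k}" for j
    using that strict_mono_onD[OF assms(3), of 1 j] by simp
  have i1: "i 1 \<in> S"
    using assms(2) by (simp add: S_def)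
  \<comment> \<open>Strict monotonicity makes \<open>i 1\<close> the least element of
    \<open>S\<close>, and \<open>S\<close> contains no 0.\<close>
  have one: "1 \<in> S \<longleftrightarrow> i 1 = 1"
  proof
    assume "1 \<in> S"
    then obtain j where j: "j \<in> {1..k}" "i j = 1"
      by (auto simp: S_def)
    have "1 \<le> i 1"
      using i1 S by auto
    with j min[of j] show "i 1 = 1"
      by (cases "j = 1") auto
  qed (use i1 in simp)
  have "nonadj (S - {1}) \<and> 2 \<in> S \<longleftrightarrow> sparse_set (n - 2) T" if "i 1 = 1"
  proof -
    have split: "{1..k} = insert 1 {2..k}"
      using assms(2) by auto
    have "1 \<notin> i ` {2..k}"
      using min that by force
    then have "S - {1} = i ` {2..k}"
      unfolding S_def split using that by simp
    then have T: "T = (\<lambda>j. j - 1) ` (S - {1})"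
      by (simp add: T_def image_image)
    \<comment> \<open>The shift is undone by \<open>Suc\<close> because 0 is not in
      \<open>S\<close>; truncated subtraction would send both 0 and 1 to 0.\<close>
    have mem: "j \<in> T \<longleftrightarrow> Suc j \<in> S - {1}" for j
    proof
      assume "j \<in> T"
      then obtain s where "s \<in> S - {1}" "j = s - 1"
        unfolding T by blast
      moreover have "1 \<le> s"
        using \<open>s \<in> S - {1}\<close> S by auto
      ultimately show "Suc j \<in> S - {1}"
        by simp
    qed (force simp: T)
    have "T \<subseteq> {1..n - 2}"
    proof
      fix j
      assume "j \<in> T"
      \<comment> \<open>The removal of 1 from \<open>S\<close> keeps 0 out of
        \<open>T\<close>.\<close>
      then have "Suc j \<noteq> 1" "Suc j \<le> n - 1"
        using mem S by auto
      then show "j \<in> {1..n - 2}" by simp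
    qed
    moreover have "nonadj (S - {1}) \<longleftrightarrow> nonadj T"
    proof
      assume "nonadj (S - {1})"
      then show "nonadj T"
        by (auto simp: nonadj_def mem simp del: Diff_iff)
    next
      assume T: "nonadj T"
      show "nonadj (S - {1})"
        unfolding nonadj_def
      proof
        fix j
        assume j: "j \<in> S - {1}"
        then obtain l where l: "j = Suc l"
          using S by (cases j) auto
        then have "l \<in> T"
          using j mem by simp
        then have "Suc l \<notin> T"
          using T by (simp add: nonadj_def)
        then show "Suc j \<notin> S - {1}"
          using l mem by simp
      qed
    qed
    moreover have "2 \<in> S \<longleftrightarrow> 1 \<in> T"
      using mem[of 1] by (simp add: numeral_2_eq_2)
    ultimately show ?thesis
      unfolding sparse_set_iff_nonadj by argo
  qed
  then show ?thesis
    using NBB_base_Zero_hat_iff[OF assms(1) S] one unfolding X T_def by argo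
qed

end
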